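(* In flat Minkowski spacetime with metric $g=\mathrm{diag}(-1,1,1,1)$ in Cartesian coordinates $(x^0,x^1,x^2,x^3)=(t,x,y,z)$, let $A_\mu$ be a smooth four-vector potential, $Z$ a smooth scalar field, $F_{\mu\nu}=\partial_\mu A_\nu-\partial_\nu A_\mu$, and consider the Lorentz-invariant Lagrangian density $$\Lambda=-\tfrac14F_{\mu\nu}F^{\mu\nu}-\tfrac12(\partial_\mu A^\mu)^2-\tfrac12g^{\mu\nu}\partial_\mu Z\,\partial_\nu Z .$$ Let ${}^*F^{\mu\nu}=\frac12\epsilon^{\mu\nu\alpha\beta}F_{\alpha\beta}$, $n^\mu=(1,0,0,0)$, and define $$\psi=\partial_\mu A^\mu,\qquad \phi=-\partial_tZ,\qquad E_i=F_{i\nu}n^\nu,\qquad B_i={}^*F_{i\nu}n^\nu+\partial_iZ=(\nabla\times\mathbf{A})_i+\partial_iZ .$$ Suppose $(A_\mu,Z)$ satisfies the Euler--Lagrange equations of $\Lambda$ with respect to $Z$ and $A_\mu$. Then $g^{\alpha\beta}\partial_\alpha\partial_\beta Z=0$ and $$\partial_\nu\big({}^*F^{\mu\nu}-n^\nu\partial^\mu Z-g^{\mu\nu}\phi\big)=0,\qquad \partial_\nu\big(F^{\mu\nu}-g^{\mu\nu}\psi\big)=0,$$ and in consequence $(\mathbf{B},\phi,\mathbf{E},\psi)$ satisfies the Maxwell-GLM system with unit speeds: $$\partial_t\mathbf{B}+\nabla\times\mathbf{E}+\nabla\phi=0,\quad \partial_t\phi+\nabla\cdot\mathbf{B}=0,\quad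 \partial_t\mathbf{E}-\nabla\times\mathbf{B}+\nabla\psi=0,\quad \partial_t\psi+\nabla\cdot\mathbf{E}=0.$$
   Context: Greek indices run over $0,\dots,3$, Latin over $1,2,3$; repeated indices are summed; indices are raised and lowered with $g$. $\epsilon^{\mu\nu\alpha\beta}$ is the four-dimensional Levi-Civita tensor with sign convention $\epsilon^{0123}=+1$, so that ${}^*F^{0i}=(\nabla\times\mathbf{A})_i$, where $\mathbf{A}=(A_1,A_2,A_3)$. The Euler--Lagrange equations are $\partial_\mu\frac{\partial\Lambda}{\partial(\partial_\mu u)}-\frac{\partial\Lambda}{\partial u}=0$ for $u=Z$ and $u=A_\nu$, $\nu=0,\dots,3$. Units are such that the light speed and the cleaning speed both equal $1$. *)

theory Defs
  imports "HOL-Analysis.Analysis"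
begin

section \<open>Partial derivatives, smooth scalar fields, Euler--Lagrange equations\<close>

text \<open>
  Spacetime is \<open>real^4\<close>.  In the index type \<open>4\<close> the four elements are \<open>0, 1, 2, 3\<close> (with \<open>4 = 0\<close>),
  so these numerals are exactly the Greek indices, and the Latin indices are its elements \<open>1, 2, 3\<close>.
  A tensor field is given by its component functions; whether an index is upper or lower is
  stated where each object is defined.
\<close>

type_synonym scalar_field = "real^4 \<Rightarrow> real"

definition partial :: "'i::finite \<Rightarrow> (real^'i \<Rightarrow> real) \<Rightarrow> real^'i \<Rightarrow> real" where
  "partial i f x = deriv (\<lambda>h. f (x + h *\<^sub>R axis i 1)) 0"

text \<open>
  Total differentiability of all iterated partial derivatives is the same as existence and
  continuity of the partial derivatives of all orders.
\<close>

definition smooth :: "(real^'i::finite \<Rightarrow> real) \<Rightarrow> bool" where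
  "smooth f \<longleftrightarrow> (\<forall>is x. foldr partial is f differentiable (at x))"

text \<open>
  A first-order Lagrangian density for a family of scalar fields \<open>u a\<close> is a function \<open>L q p\<close> of
  independent variables \<open>q $ a\<close> (for \<open>u a\<close>) and \<open>p $ (a, \<mu>)\<close> (for the derivative of \<open>u a\<close> in
  direction \<open>\<mu>\<close>).
\<close>

definition field_values :: "('k::finite \<Rightarrow> scalar_field) \<Rightarrow> real^4 \<Rightarrow> real^'k" where
  "field_values u x = (\<chi> a. u a x)"

definition field_gradients :: "('k::finite \<Rightarrow> scalar_field) \<Rightarrow> real^4 \<Rightarrow> real^('k \<times> 4)" where
  "field_gradients u x = (\<chi> i. partial (snd i) (u (fst i)) x)"

definition euler_lagrange ::
    "(real^'k \<Rightarrow> real^('k \<times> 4) \<Rightarrow> real) \<Rightarrow> ('k::finite \<Rightarrow> scalar_field) \<Rightarrow> 'k \<Rightarrow> bool" where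
  "euler_lagrange L u a \<longleftrightarrow>
     (\<forall>x. (\<Sum>\<mu>\<in>UNIV. partial \<mu>
              (\<lambda>y. partial (a, \<mu>) (\<lambda>p. L (field_values u y) p) (field_gradients u y)) x)
          - partial a (\<lambda>q. L q (field_gradients u x)) (field_values u x) = 0)"

section \<open>Minkowski space\<close>

definition minkowski :: "4 \<Rightarrow> 4 \<Rightarrow> real" where
  "minkowski \<mu> \<nu> = (if \<mu> = \<nu> then (if \<mu> = 0 then -1 else 1) else 0)"

lemma index_4_UNIV: "(UNIV :: 4 set) = {0, 1, 2, 3}"
proof -
  have "(4::4) = 0" by simp
  then show ?thesis by (metis UNIV_4 insert_commute)
qed

text \<open>The metric is its own inverse, so \<open>minkowski\<close> serves for both the lower and the upper components.\<close>

lemma minkowski_inverse: "(\<Sum>\<alpha>\<in>UNIV. minkowski \<mu> \<alpha> * minkowski \<alpha> \<nu>) = (if \<mu> = \<nu> then 1 else 0)"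
proof -
  have "(\<Sum>\<alpha>\<in>UNIV. minkowski \<mu> \<alpha> * minkowski \<alpha> \<nu>)
      = (\<Sum>\<alpha>\<in>UNIV. if \<alpha> = \<mu> then minkowski \<mu> \<mu> * minkowski \<mu> \<nu> else 0)"
    by (rule sum.cong) (simp_all add: minkowski_def)
  then show ?thesis
    by (simp add: minkowski_def)
qed

definition raise1 :: "(4 \<Rightarrow> real) \<Rightarrow> 4 \<Rightarrow> real" where
  "raise1 v \<mu> = (\<Sum>\<alpha>\<in>UNIV. minkowski \<mu> \<alpha> * v \<alpha>)"

definition raise2 :: "(4 \<Rightarrow> 4 \<Rightarrow> real) \<Rightarrow> 4 \<Rightarrow> 4 \<Rightarrow> real" where
  "raise2 T \<mu> \<nu> = (\<Sum>\<alpha>\<in>UNIV. \<Sum>\<beta>\<in>UNIV. minkowski \<mu> \<alpha> * minkowski \<nu> \<beta> * T \<alpha> \<beta>)"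

definition lower2 :: "(4 \<Rightarrow> 4 \<Rightarrow> real) \<Rightarrow> 4 \<Rightarrow> 4 \<Rightarrow> real" where
  "lower2 T \<mu> \<nu> = (\<Sum>\<alpha>\<in>UNIV. \<Sum>\<beta>\<in>UNIV. minkowski \<mu> \<alpha> * minkowski \<nu> \<beta> * T \<alpha> \<beta>)"

text \<open>Upper components; in Cartesian coordinates the volume factor is 1.\<close>

definition levi_civita :: "4 \<Rightarrow> 4 \<Rightarrow> 4 \<Rightarrow> 4 \<Rightarrow> real" where
  "levi_civita \<mu> \<nu> \<alpha> \<beta> =
     (if distinct [\<mu>, \<nu>, \<alpha>, \<beta>]
      then of_int (sign (\<lambda>i::4. if i = 0 then \<mu> else if i = 1 then \<nu> else if i = 2 then \<alpha> else \<beta>))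
      else 0)"

lemma levi_civita_0123: "levi_civita 0 1 2 3 = 1"
proof -
  have "(i = 0 \<or> i = 1 \<or> i = 2 \<or> i = 3)" for i :: 4
    using index_4_UNIV by blast
  then have "(\<lambda>i::4. if i = 0 then 0 else if i = 1 then 1 else if i = 2 then 2 else 3) = id"
    by (force simp: fun_eq_iff)
  then show ?thesis
    by (simp add: levi_civita_def)
qed

definition time_vec :: "4 \<Rightarrow> real" where
  "time_vec \<mu> = (if \<mu> = 0 then 1 else 0)"

section \<open>The Lagrangian density\<close>

text \<open>The scalar components of the pair \<open>(Z, A)\<close>; \<open>PotA \<nu>\<close> is the lower component \<open>\<nu>\<close> of \<open>A\<close>.\<close>

datatype component = ScalZ | PotA 4

instance component :: finite
proof
  have "UNIV \<subseteq> insert ScalZ (range PotA)"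
  proof
    fix c show "c \<in> insert ScalZ (range PotA)" by (cases c) simp_all
  qed
  then show "finite (UNIV :: component set)"
    by (rule finite_subset) simp
qed

fun fields :: "(4 \<Rightarrow> scalar_field) \<Rightarrow> scalar_field \<Rightarrow> component \<Rightarrow> scalar_field" where
  "fields A Z ScalZ = Z"
| "fields A Z (PotA \<nu>) = A \<nu>"

text \<open>In terms of independent variables: \<open>dA \<mu> \<nu>\<close> stands for \<open>\<partial>\<^sub>\<mu> A\<^sub>\<nu>\<close> and \<open>dZ \<mu>\<close> for \<open>\<partial>\<^sub>\<mu> Z\<close>.\<close>

definition lagrangian :: "real^component \<Rightarrow> real^(component \<times> 4) \<Rightarrow> real" where
  "lagrangian q p =
     (let dA = (\<lambda>\<mu> \<nu>. p $ (PotA \<nu>, \<mu>)); dZ = (\<lambda>\<mu>. p $ (ScalZ, \<mu>));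
          F = (\<lambda>\<mu> \<nu>. dA \<mu> \<nu> - dA \<nu> \<mu>)
      in - (1/4) * (\<Sum>\<mu>\<in>UNIV. \<Sum>\<nu>\<in>UNIV. F \<mu> \<nu> * raise2 F \<mu> \<nu>)
         - (1/2) * (\<Sum>\<mu>\<in>UNIV. raise1 (dA \<mu>) \<mu>)\<^sup>2
         - (1/2) * (\<Sum>\<mu>\<in>UNIV. \<Sum>\<nu>\<in>UNIV. minkowski \<mu> \<nu> * dZ \<mu> * dZ \<nu>))"

section \<open>The derived fields\<close>

text \<open>\<open>Fdown\<close> has lower indices, \<open>Fup\<close> and \<open>dualFup\<close> upper ones, \<open>dualFdown\<close> lower ones.\<close>

definition Fdown :: "(4 \<Rightarrow> scalar_field) \<Rightarrow> 4 \<Rightarrow> 4 \<Rightarrow> scalar_field" where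
  "Fdown A \<mu> \<nu> x = partial \<mu> (A \<nu>) x - partial \<nu> (A \<mu>) x"

definition Fup :: "(4 \<Rightarrow> scalar_field) \<Rightarrow> 4 \<Rightarrow> 4 \<Rightarrow> scalar_field" where
  "Fup A \<mu> \<nu> x = raise2 (\<lambda>\<alpha> \<beta>. Fdown A \<alpha> \<beta> x) \<mu> \<nu>"

definition dualFup :: "(4 \<Rightarrow> scalar_field) \<Rightarrow> 4 \<Rightarrow> 4 \<Rightarrow> scalar_field" where
  "dualFup A \<mu> \<nu> x =
     (1/2) * (\<Sum>\<alpha>\<in>UNIV. \<Sum>\<beta>\<in>UNIV. levi_civita \<mu> \<nu> \<alpha> \<beta> * Fdown A \<alpha> \<beta> x)"

definition dualFdown :: "(4 \<Rightarrow> scalar_field) \<Rightarrow> 4 \<Rightarrow> 4 \<Rightarrow> scalar_field" where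
  "dualFdown A \<mu> \<nu> x = lower2 (\<lambda>\<alpha> \<beta>. dualFup A \<alpha> \<beta> x) \<mu> \<nu>"

definition psi_field :: "(4 \<Rightarrow> scalar_field) \<Rightarrow> scalar_field" where
  "psi_field A x = (\<Sum>\<mu>\<in>UNIV. partial \<mu> (\<lambda>y. raise1 (\<lambda>\<alpha>. A \<alpha> y) \<mu>) x)"

definition phi_field :: "scalar_field \<Rightarrow> scalar_field" where
  "phi_field Z x = - partial 0 Z x"

lemma lagrangian_along_fields:
  assumes "\<And>\<nu>. smooth (A \<nu>)"
  shows "lagrangian (field_values (fields A Z) x) (field_gradients (fields A Z) x) =
      - (1/4) * (\<Sum>\<mu>\<in>UNIV. \<Sum>\<nu>\<in>UNIV. Fdown A \<mu> \<nu> x * Fup A \<mu> \<nu> x)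
      - (1/2) * (psi_field A x)\<^sup>2
      - (1/2) * (\<Sum>\<mu>\<in>UNIV. \<Sum>\<nu>\<in>UNIV. minkowski \<mu> \<nu> * partial \<mu> Z x * partial \<nu> Z x)"
proof -
  have diff: "(\<lambda>h. A \<alpha> (x + h *\<^sub>R axis \<mu> 1)) field_differentiable (at 0)" for \<alpha> \<mu>
  proof -
    have "A \<alpha> differentiable (at (x + 0 *\<^sub>R axis \<mu> 1))"
      using assms[of \<alpha>] unfolding smooth_def by (metis foldr.simps(1) id_apply)
    moreover have "(\<lambda>h::real. x + h *\<^sub>R axis \<mu> 1) differentiable (at 0)"
      by (intro derivative_intros)
    ultimately have "(A \<alpha> \<circ> (\<lambda>h. x + h *\<^sub>R axis \<mu> 1)) differentiable (at 0)"
      by (intro differentiable_chain_at)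
    then show ?thesis
      by (simp add: o_def real_differentiable_def field_differentiable_def)
  qed
  have "psi_field A x = (\<Sum>\<mu>\<in>UNIV. raise1 (\<lambda>\<alpha>. partial \<mu> (A \<alpha>) x) \<mu>)"
    unfolding psi_field_def partial_def raise1_def
    by (intro sum.cong refl, subst deriv_sum)
       (auto intro!: field_differentiable_mult diff sum.cong deriv_cmult simp: field_differentiable_const)
  then show ?thesis
    by (simp add: lagrangian_def field_gradients_def Fup_def Fdown_def)
qed

section \<open>Spatial vector calculus\<close>

type_synonym vector_field = "real^4 \<Rightarrow> real^3"

definition spatial :: "(4 \<Rightarrow> real) \<Rightarrow> real^3" where
  "spatial v = vector [v 1, v 2, v 3]"

definition d_t :: "vector_field \<Rightarrow> vector_field" where
  "d_t V x = (\<chi> i. partial 0 (\<lambda>y. V y $ i) x)"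

definition grad :: "scalar_field \<Rightarrow> vector_field" where
  "grad f x = spatial (\<lambda>i. partial i f x)"

definition divergence :: "vector_field \<Rightarrow> scalar_field" where
  "divergence V x =
     partial 1 (\<lambda>y. V y $ 1) x + partial 2 (\<lambda>y. V y $ 2) x + partial 3 (\<lambda>y. V y $ 3) x"

definition curl :: "vector_field \<Rightarrow> vector_field" where
  "curl V x = vector
     [partial 2 (\<lambda>y. V y $ 3) x - partial 3 (\<lambda>y. V y $ 2) x,
      partial 3 (\<lambda>y. V y $ 1) x - partial 1 (\<lambda>y. V y $ 3) x,
      partial 1 (\<lambda>y. V y $ 2) x - partial 2 (\<lambda>y. V y $ 1) x]"

text \<open>The vector potential has the lower components \<open>A\<^sub>1, A\<^sub>2, A\<^sub>3\<close>.\<close>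

definition vector_potential :: "(4 \<Rightarrow> scalar_field) \<Rightarrow> vector_field" where
  "vector_potential A x = spatial (\<lambda>i. A i x)"

definition E_field :: "(4 \<Rightarrow> scalar_field) \<Rightarrow> vector_field" where
  "E_field A x = spatial (\<lambda>i. \<Sum>\<nu>\<in>UNIV. Fdown A i \<nu> x * time_vec \<nu>)"

definition B_field :: "(4 \<Rightarrow> scalar_field) \<Rightarrow> scalar_field \<Rightarrow> vector_field" where
  "B_field A Z x = spatial (\<lambda>i. (\<Sum>\<nu>\<in>UNIV. dualFdown A i \<nu> x * time_vec \<nu>) + partial i Z x)"

end

theory Submission
  imports Defs
begin

text \<open>
  \<^const>\<open>lagrangian\<close> depends on the first derivatives of the fields only and is a quadratic form in
  them, so each Euler--Lagrange equation says that the divergence of a linear expression in the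
  first derivatives vanishes (\<open>euler_lagrange_imp_divergence\<close>). For \<open>Z\<close> this expression is
  \<open>- \<partial>\<^sup>\<mu> Z\<close>, which gives the wave equation (\<open>wave_equation\<close>). For \<open>A\<^sub>\<nu>\<close> it is
  \<open>- F\<^sup>\<mu>\<^sup>\<nu> - g\<^sup>\<mu>\<^sup>\<nu> \<psi> = F\<^sup>\<nu>\<^sup>\<mu> - g\<^sup>\<nu>\<^sup>\<mu> \<psi>\<close>: the antisymmetry of \<open>F\<close> turns the
  Euler--Lagrange equation itself into the claimed conservation law (\<open>field_equation\<close>). The
  gauge-fixing term \<open>- (1/2) \<psi>\<^sup>2\<close> is what puts \<open>\<psi>\<close> into this flux.

  Everything else comes from the symmetry of second partial derivatives
  (\<open>smooth_partial_commute\<close>). The law for the dual tensor is an identity, valid for all smooth fields: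
  \<open>\<partial>\<^sub>\<nu> *F\<^sup>\<mu>\<^sup>\<nu> = 0\<close> is the Bianchi identity, and the two remaining terms
  \<open>- \<partial>\<^sub>0 \<partial>\<^sup>\<mu> Z\<close> and \<open>- \<partial>\<^sup>\<mu> \<phi> = \<partial>\<^sup>\<mu> \<partial>\<^sub>0 Z\<close> cancel. The same cancellation gives Faraday's
  law. The divergence of \<open>B = \<nabla>\<times>A + \<nabla>Z\<close> is the Laplacian of \<open>Z\<close>, so the equation for
  \<open>\<phi>\<close> is the wave equation. The equations for \<open>E\<close> and \<open>\<psi>\<close> are the components \<open>\<mu> = 1, 2, 3\<close>
  and \<open>\<mu> = 0\<close> of the conservation law for \<open>F\<close>, where adding \<open>\<nabla>Z\<close> to the magnetic field
  leaves its curl unchanged.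
\<close>

section \<open>Calculus of partial derivatives\<close>

lemma has_derivative_along_axis:
  fixes f :: "real^'i::finite \<Rightarrow> real"
  assumes "(f has_derivative L) (at (x + s *\<^sub>R axis i 1))"
  shows "((\<lambda>h. f (x + h *\<^sub>R axis i 1)) has_real_derivative L (axis i 1)) (at s)"
proof -
  have "((\<lambda>h::real. x + h *\<^sub>R axis i 1) has_derivative (\<lambda>h. h *\<^sub>R axis i 1)) (at s)"
    by (auto intro!: derivative_eq_intros)
  from has_derivative_compose[OF this assms]
  have "((\<lambda>h. f (x + h *\<^sub>R axis i 1)) has_derivative (\<lambda>h. L (h *\<^sub>R axis i 1))) (at s)" .
  moreover have "(\<lambda>h. L (h *\<^sub>R axis i 1)) = (*) (L (axis i 1))"
    using has_derivative_linear[OF assms] by (auto simp: linear_cmul mult.commute)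
  ultimately show ?thesis
    by (simp add: has_field_derivative_def)
qed

text \<open>
  Since \<^const>\<open>partial\<close> is given by \<^const>\<open>deriv\<close>, it means nothing without differentiability; for
  differentiable functions this evaluation of the total derivative yields all the rules below.
\<close>

lemma partial_eq_has_derivative:
  assumes "(f has_derivative L) (at x)"
  shows "partial i f x = L (axis i 1)"
  using has_derivative_along_axis[of f L x 0 i] assms
  by (auto simp: partial_def intro!: DERIV_imp_deriv)

lemma has_real_derivative_along_axis:
  assumes "f differentiable (at (x + s *\<^sub>R axis i 1))"
  shows "((\<lambda>h. f (x + h *\<^sub>R axis i 1)) has_real_derivative partial i f (x + s *\<^sub>R axis i 1)) (at s)"
  using assms has_derivative_along_axis partial_eq_has_derivative
  unfolding differentiable_def by metis

lemma partial_const [simp]: "partial i (\<lambda>x. c) x = 0"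
  by (simp add: partial_def)

lemma partial_minus:
  assumes "f differentiable (at x)"
  shows "partial i (\<lambda>y. - f y) x = - partial i f x"
proof -
  obtain L where L: "(f has_derivative L) (at x)"
    using assms unfolding differentiable_def by blast
  show ?thesis
    by (simp add: partial_eq_has_derivative[OF L] partial_eq_has_derivative[OF has_derivative_minus[OF L]])
qed

lemma partial_add:
  assumes "f differentiable (at x)" "g differentiable (at x)"
  shows "partial i (\<lambda>y. f y + g y) x = partial i f x + partial i g x"
proof -
  obtain L M where L: "(f has_derivative L) (at x)" and M: "(g has_derivative M) (at x)"
    using assms unfolding differentiable_def by blast
  show ?thesis
    by (simp add: partial_eq_has_derivative[OF L] partial_eq_has_derivative[OF M]
        partial_eq_has_derivative[OF has_derivative_add[OF L M]])
qed

lemma partial_diff: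
  assumes "f differentiable (at x)" "g differentiable (at x)"
  shows "partial i (\<lambda>y. f y - g y) x = partial i f x - partial i g x"
  using partial_add[of f x "\<lambda>y. - g y"] assms by (simp add: partial_minus)

lemma partial_cmult:
  assumes "f differentiable (at x)"
  shows "partial i (\<lambda>y. c * f y) x = c * partial i f x"
proof -
  obtain L where L: "(f has_derivative L) (at x)"
    using assms unfolding differentiable_def by blast
  show ?thesis
    by (simp add: partial_eq_has_derivative[OF L] partial_eq_has_derivative[OF has_derivative_mult_right[OF L]])
qed

lemmas partial_linear = partial_minus partial_add partial_diff partial_cmult

text \<open>
  The second difference of \<open>f\<close> in the directions \<open>i\<close> and \<open>j\<close>, divided by \<open>h\<^sup>2\<close>, approximates
  \<open>\<partial>\<^sub>j \<partial>\<^sub>i f\<close>: the mean value theorem in direction \<open>i\<close> turns it into a difference quotient of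
  \<open>\<partial>\<^sub>i f\<close> between two points at distance \<open>O(h)\<close> from \<open>x\<close>, where the total derivative of
  \<open>\<partial>\<^sub>i f\<close> at \<open>x\<close> is accurate up to \<open>o(h)\<close>.
\<close>

lemma second_difference_tendsto:
  fixes f :: "real^'i::finite \<Rightarrow> real"
  assumes f: "\<And>y. f differentiable (at y)" and fi: "partial i f differentiable (at x)"
  shows "((\<lambda>h. (f (x + h *\<^sub>R axis i 1 + h *\<^sub>R axis j 1) - f (x + h *\<^sub>R axis i 1)
              - f (x + h *\<^sub>R axis j 1) + f x) / h\<^sup>2) \<longlongrightarrow> partial j (partial i f) x) (at_right 0)"
    (is "(?q \<longlongrightarrow> _) _")
proof -
  obtain L where L: "(partial i f has_derivative L) (at x)"
    using fi unfolding differentiable_def by blast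
  have lin: "linear L" using has_derivative_linear[OF L] .
  show ?thesis
    unfolding partial_eq_has_derivative[OF L]
  proof (rule tendstoI)
    fix e :: real assume "e > 0"
    \<comment> \<open>The two points \<open>v\<close>, \<open>w\<close> below have distance at most \<open>2 * h\<close> and \<open>h\<close> from \<open>x\<close>, so
      errors at rate \<open>e / 4\<close> add up to \<open>3 / 4 * e * h\<close>.\<close>
    then have "e / 4 > 0" by simp
    then obtain d where "d > 0"
      and d: "\<And>v. norm (v - x) < d \<Longrightarrow>
          norm (partial i f v - partial i f x - L (v - x)) \<le> e / 4 * norm (v - x)"
      using L unfolding has_derivative_at_alt by blast
    have "dist (?q h) (L (axis j 1)) < e" if h: "h > 0" "h < d / 2" for h
    proof -
      define g where "g s = f ((x + h *\<^sub>R axis j 1) + s *\<^sub>R axis i 1) - f (x + s *\<^sub>R axis i 1)" for s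
      have "\<exists>s. 0 < s \<and> s < h \<and> g h - g 0 = (h - 0) *
          (partial i f ((x + h *\<^sub>R axis j 1) + s *\<^sub>R axis i 1) - partial i f (x + s *\<^sub>R axis i 1))"
        unfolding g_def
        by (rule MVT2[OF h(1)]) (intro DERIV_diff has_real_derivative_along_axis f)
      then obtain s where s: "0 < s" "s < h" and
        gs: "g h - g 0 = h *
          (partial i f ((x + h *\<^sub>R axis j 1) + s *\<^sub>R axis i 1) - partial i f (x + s *\<^sub>R axis i 1))"
        by auto
      define v w where "v = (x + h *\<^sub>R axis j 1) + s *\<^sub>R axis i 1" and "w = x + s *\<^sub>R axis i 1"
      have nv: "norm (v - x) \<le> 2 * h"
      proof -
        have "norm (v - x) \<le> norm (h *\<^sub>R axis j (1::real)) + norm (s *\<^sub>R axis i (1::real))"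
          unfolding v_def by (metis add.assoc add_diff_cancel_left' norm_triangle_ineq)
        also have "\<dots> \<le> 2 * h" using h s by (simp add: norm_axis_1)
        finally show ?thesis .
      qed
      have nw: "norm (w - x) \<le> h"
        using s by (simp add: w_def norm_axis_1)
      have "\<bar>partial i f v - partial i f x - L (v - x)\<bar> \<le> e / 4 * norm (v - x)"
        using d[of v] nv h by simp
      also have "\<dots> \<le> e / 4 * (2 * h)" using nv \<open>e > 0\<close> by (intro mult_left_mono) auto
      finally have 1: "\<bar>partial i f v - partial i f x - L (v - x)\<bar> \<le> e / 4 * (2 * h)" .
      have "\<bar>partial i f w - partial i f x - L (w - x)\<bar> \<le> e / 4 * norm (w - x)"
        using d[of w] nw h by simp
      also have "\<dots> \<le> e / 4 * h" using nw \<open>e > 0\<close> by (intro mult_left_mono) auto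
      finally have 2: "\<bar>partial i f w - partial i f x - L (w - x)\<bar> \<le> e / 4 * h" .
      have "L (v - x) - L (w - x) = L (h *\<^sub>R axis j 1)"
        by (simp add: v_def w_def linear_diff[OF lin, symmetric])
      also have "\<dots> = h * L (axis j 1)" by (simp add: linear_cmul[OF lin])
      finally have "\<bar>partial i f v - partial i f w - h * L (axis j 1)\<bar> \<le> 3 / 4 * e * h"
        using 1 2 by linarith
      moreover have "?q h = (partial i f v - partial i f w) / h"
      proof -
        have "g h - g 0 = h * (partial i f v - partial i f w)"
          using gs by (simp add: v_def w_def)
        moreover have "?q h = (g h - g 0) / h\<^sup>2"
          by (simp add: g_def algebra_simps)
        ultimately show ?thesis
          using h(1) by (simp add: power2_eq_square)
      qed
      moreover have "(partial i f v - partial i f w) / h - L (axis j 1)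
          = (partial i f v - partial i f w - h * L (axis j 1)) / h"
        using h(1) by (simp add: field_simps)
      ultimately have "\<bar>?q h - L (axis j 1)\<bar> \<le> 3 / 4 * e"
        using h(1) by (simp add: divide_le_eq)
      then show ?thesis using \<open>e > 0\<close> by (simp add: dist_real_def)
    qed
    then show "\<forall>\<^sub>F h in at_right 0. dist (?q h) (L (axis j 1)) < e"
      using \<open>d > 0\<close> by (auto simp: eventually_at_right_field intro!: exI[of _ "d / 2"])
  qed
qed

text \<open>
  Young's theorem. The second difference is symmetric in \<open>i\<close> and \<open>j\<close>, so both mixed derivatives
  are the limit of the same quotient.
\<close>

lemma partial_commute:
  fixes f :: "real^'i::finite \<Rightarrow> real"
  assumes "\<And>y. f differentiable (at y)"
    and "partial i f differentiable (at x)" "partial j f differentiable (at x)"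
  shows "partial i (partial j f) x = partial j (partial i f) x"
proof (rule tendsto_unique)
  show "at_right (0::real) \<noteq> bot" by simp
  show "((\<lambda>h. (f (x + h *\<^sub>R axis i 1 + h *\<^sub>R axis j 1) - f (x + h *\<^sub>R axis i 1)
              - f (x + h *\<^sub>R axis j 1) + f x) / h\<^sup>2) \<longlongrightarrow> partial j (partial i f) x) (at_right 0)"
    by (rule second_difference_tendsto[OF assms(1,2)])
  show "((\<lambda>h. (f (x + h *\<^sub>R axis i 1 + h *\<^sub>R axis j 1) - f (x + h *\<^sub>R axis i 1)
              - f (x + h *\<^sub>R axis j 1) + f x) / h\<^sup>2) \<longlongrightarrow> partial i (partial j f) x) (at_right 0)"
    using second_difference_tendsto[OF assms(1,3), of i] by (simp add: algebra_simps)
qed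

lemma smooth_differentiable: "smooth f \<Longrightarrow> f differentiable (at x)"
  unfolding smooth_def by (metis foldr.simps(1) id_apply)

lemma smooth_partial: "smooth f \<Longrightarrow> smooth (partial i f)"
  unfolding smooth_def
proof (intro allI)
  fix "is" x assume "\<forall>is x. foldr partial is f differentiable (at x)"
  then have "foldr partial (is @ [i]) f differentiable (at x)" by blast
  then show "foldr partial is (partial i f) differentiable (at x)" by simp
qed

lemma smooth_partial_commute:
  assumes "smooth f"
  shows "partial i (partial j f) x = partial j (partial i f) x"
  by (intro partial_commute smooth_differentiable smooth_partial assms)

section \<open>Index calculus\<close>

lemma exhaust_index: "(\<mu>::4) = 0 \<or> \<mu> = 1 \<or> \<mu> = 2 \<or> \<mu> = 3"
  using index_4_UNIV by blast

lemma sum_index: "sum f (UNIV :: 4 set) = f 0 + f 1 + f 2 + f 3"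
  unfolding index_4_UNIV by (simp add: add.assoc)

lemma raise1_diagonal: "raise1 v \<mu> = minkowski \<mu> \<mu> * v \<mu>"
  using exhaust_index[of \<mu>] by (auto simp: raise1_def sum_index minkowski_def)

lemma raise2_diagonal: "raise2 T \<mu> \<nu> = minkowski \<mu> \<mu> * minkowski \<nu> \<nu> * T \<mu> \<nu>"
  using exhaust_index[of \<mu>] exhaust_index[of \<nu>] by (auto simp: raise2_def sum_index minkowski_def)

lemma lower2_diagonal: "lower2 T \<mu> \<nu> = minkowski \<mu> \<mu> * minkowski \<nu> \<nu> * T \<mu> \<nu>"
  using raise2_diagonal[of T \<mu> \<nu>] by (simp add: lower2_def raise2_def)

text \<open>
  Adjacent transpositions generate all permutations, so these three rules together with the value
  at \<open>0 1 2 3\<close> determine the symbol. Each one composes the permutation in the definition of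
  \<^const>\<open>levi_civita\<close> with a transposition, which flips its sign.
\<close>

lemma levi_civita_swap:
  shows "levi_civita \<nu> \<mu> \<alpha> \<beta> = - levi_civita \<mu> \<nu> \<alpha> \<beta>"
    and "levi_civita \<mu> \<alpha> \<nu> \<beta> = - levi_civita \<mu> \<nu> \<alpha> \<beta>"
    and "levi_civita \<mu> \<nu> \<beta> \<alpha> = - levi_civita \<mu> \<nu> \<alpha> \<beta>"
proof -
  define f where "f \<mu> \<nu> \<alpha> \<beta> = (\<lambda>i::4. if i = 0 then \<mu> else if i = 1 then \<nu> else if i = 2 then \<alpha> else \<beta>)"
    for \<mu> \<nu> \<alpha> \<beta> :: 4
  have lc: "levi_civita \<mu> \<nu> \<alpha> \<beta> = (if distinct [\<mu>, \<nu>, \<alpha>, \<beta>] then of_int (sign (f \<mu> \<nu> \<alpha> \<beta>)) else 0)"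
    for \<mu> \<nu> \<alpha> \<beta>
    by (simp add: levi_civita_def f_def)
  have sgn: "sign (f \<mu> \<nu> \<alpha> \<beta> \<circ> Transposition.transpose a b) = - sign (f \<mu> \<nu> \<alpha> \<beta>)"
    if "distinct [\<mu>, \<nu>, \<alpha>, \<beta>]" "a \<noteq> b" for a b
  proof -
    have "inj (f \<mu> \<nu> \<alpha> \<beta>)"
    proof (rule injI)
      fix i j assume "f \<mu> \<nu> \<alpha> \<beta> i = f \<mu> \<nu> \<alpha> \<beta> j"
      then show "i = j"
        using that(1) exhaust_index[of i] exhaust_index[of j] by (auto simp: f_def)
    qed
    then have "permutation (f \<mu> \<nu> \<alpha> \<beta>)"
      by (simp add: permutation bij_def finite_UNIV_inj_surj)
    then show ?thesis
      using that(2) by (simp add: sign_compose permutation_swap_id sign_swap_id)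
  qed
  have eq: "f \<nu> \<mu> \<alpha> \<beta> = f \<mu> \<nu> \<alpha> \<beta> \<circ> Transposition.transpose 0 1"
    "f \<mu> \<alpha> \<nu> \<beta> = f \<mu> \<nu> \<alpha> \<beta> \<circ> Transposition.transpose 1 2"
    "f \<mu> \<nu> \<beta> \<alpha> = f \<mu> \<nu> \<alpha> \<beta> \<circ> Transposition.transpose 2 3"
    using exhaust_index by (force simp: f_def fun_eq_iff Transposition.transpose_def)+
  show "levi_civita \<nu> \<mu> \<alpha> \<beta> = - levi_civita \<mu> \<nu> \<alpha> \<beta>"
    by (auto simp: lc eq(1) sgn)
  show "levi_civita \<mu> \<alpha> \<nu> \<beta> = - levi_civita \<mu> \<nu> \<alpha> \<beta>"
    by (auto simp: lc eq(2) sgn)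
  show "levi_civita \<mu> \<nu> \<beta> \<alpha> = - levi_civita \<mu> \<nu> \<alpha> \<beta>"
    by (auto simp: lc eq(3) sgn)
qed

lemma levi_civita_eq_0: "\<not> distinct [\<mu>, \<nu>, \<alpha>, \<beta>] \<Longrightarrow> levi_civita \<mu> \<nu> \<alpha> \<beta> = 0"
  by (simp add: levi_civita_def)

lemma levi_civita_values:
  "levi_civita 0 1 2 3 = 1" "levi_civita 0 1 3 2 = -1"
  "levi_civita 0 2 1 3 = -1" "levi_civita 0 2 3 1 = 1"
  "levi_civita 0 3 1 2 = 1" "levi_civita 0 3 2 1 = -1"
  "levi_civita 1 2 0 3 = 1" "levi_civita 1 2 3 0 = -1"
  "levi_civita 1 3 0 2 = -1" "levi_civita 1 3 2 0 = 1"
  "levi_civita 2 3 0 1 = 1" "levi_civita 2 3 1 0 = -1"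
  using levi_civita_0123 levi_civita_swap by (metis (no_types) minus_minus)+

lemma Fup_diagonal: "Fup A \<mu> \<nu> x = minkowski \<mu> \<mu> * minkowski \<nu> \<nu> * Fdown A \<mu> \<nu> x"
  by (simp add: Fup_def raise2_diagonal)

lemma Fdown_swap: "Fdown A \<nu> \<mu> x = - Fdown A \<mu> \<nu> x"
  by (simp add: Fdown_def)

lemma dualFup_swap: "dualFup A \<nu> \<mu> x = - dualFup A \<mu> \<nu> x"
  by (simp add: dualFup_def levi_civita_swap(1)[of \<nu> \<mu>] sum_negf)

text \<open>
  The sign patterns are absorbed by the order of the indices of \<open>F\<close>: in each equation the four
  indices, read from left to right, form an even permutation.
\<close>

lemma dualFup_upper_triangle:
  "dualFup A 0 1 x = Fdown A 2 3 x" "dualFup A 0 2 x = Fdown A 3 1 x" "dualFup A 0 3 x = Fdown A 1 2 x"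
  "dualFup A 1 2 x = Fdown A 0 3 x" "dualFup A 1 3 x = Fdown A 2 0 x" "dualFup A 2 3 x = Fdown A 0 1 x"
  by (simp_all add: dualFup_def sum_index levi_civita_values levi_civita_eq_0 Fdown_def)

lemma dualFup_table:
  "dualFup A \<mu> \<mu> x = 0"
  "dualFup A 1 0 x = Fdown A 3 2 x" "dualFup A 2 0 x = Fdown A 1 3 x" "dualFup A 3 0 x = Fdown A 2 1 x"
  "dualFup A 2 1 x = Fdown A 3 0 x" "dualFup A 3 1 x = Fdown A 0 2 x" "dualFup A 3 2 x = Fdown A 1 0 x"
  using dualFup_swap[of A \<mu> \<mu> x]
  by (simp_all add: dualFup_swap[of A 1 0] dualFup_swap[of A 2 0] dualFup_swap[of A 3 0]
      dualFup_swap[of A 2 1] dualFup_swap[of A 3 1] dualFup_swap[of A 3 2]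
      dualFup_upper_triangle Fdown_def)

lemma psi_field_eq:
  assumes "\<And>\<nu>. smooth (A \<nu>)"
  shows "psi_field A x = (\<Sum>\<mu>\<in>UNIV. minkowski \<mu> \<mu> * partial \<mu> (A \<mu>) x)"
  by (simp add: psi_field_def raise1_diagonal partial_cmult smooth_differentiable assms)

section \<open>The Euler--Lagrange equations\<close>

text \<open>
  Along a coordinate axis the quadratic form is a quadratic polynomial in \<open>h\<close>, and the partial
  derivative is its linear coefficient. Writing out the quadratic coefficient as well makes the claim
  a polynomial identity in the entries of \<open>p\<close> and \<open>h\<close>.
\<close>

lemma lagrangian_along_axis:
  shows "lagrangian q (p + h *\<^sub>R axis (ScalZ, \<mu>) 1) =
      lagrangian q p + h * (- minkowski \<mu> \<mu> * p $ (ScalZ, \<mu>)) + h\<^sup>2 * (- (1/2) * minkowski \<mu> \<mu>)"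
    and "lagrangian q (p + h *\<^sub>R axis (PotA \<nu>, \<mu>) 1) =
      lagrangian q p
      + h * (- (minkowski \<mu> \<mu> * minkowski \<nu> \<nu> * (p $ (PotA \<nu>, \<mu>) - p $ (PotA \<mu>, \<nu>)))
             - minkowski \<mu> \<nu> * (\<Sum>\<alpha>\<in>UNIV. minkowski \<alpha> \<alpha> * p $ (PotA \<alpha>, \<alpha>)))
      + h\<^sup>2 * (- (1/2) * minkowski \<mu> \<mu> * minkowski \<nu> \<nu>)"
proof -
  have explicit: "lagrangian q p =
      ((p $ (PotA 1, 0) - p $ (PotA 0, 1))\<^sup>2 + (p $ (PotA 2, 0) - p $ (PotA 0, 2))\<^sup>2
       + (p $ (PotA 3, 0) - p $ (PotA 0, 3))\<^sup>2 - (p $ (PotA 2, 1) - p $ (PotA 1, 2))\<^sup>2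
       - (p $ (PotA 3, 1) - p $ (PotA 1, 3))\<^sup>2 - (p $ (PotA 3, 2) - p $ (PotA 2, 3))\<^sup>2
       - (p $ (PotA 1, 1) + p $ (PotA 2, 2) + p $ (PotA 3, 3) - p $ (PotA 0, 0))\<^sup>2
       + (p $ (ScalZ, 0))\<^sup>2 - (p $ (ScalZ, 1))\<^sup>2 - (p $ (ScalZ, 2))\<^sup>2 - (p $ (ScalZ, 3))\<^sup>2) / 2"
    for q p
    by (simp add: lagrangian_def Let_def raise1_diagonal raise2_diagonal sum_index minkowski_def
        power2_eq_square algebra_simps)
  show "lagrangian q (p + h *\<^sub>R axis (ScalZ, \<mu>) 1) =
      lagrangian q p + h * (- minkowski \<mu> \<mu> * p $ (ScalZ, \<mu>)) + h\<^sup>2 * (- (1/2) * minkowski \<mu> \<mu>)"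
    using exhaust_index[of \<mu>]
    by (elim disjE; simp add: explicit axis_def minkowski_def; simp add: power2_eq_square field_simps)
  show "lagrangian q (p + h *\<^sub>R axis (PotA \<nu>, \<mu>) 1) =
      lagrangian q p
      + h * (- (minkowski \<mu> \<mu> * minkowski \<nu> \<nu> * (p $ (PotA \<nu>, \<mu>) - p $ (PotA \<mu>, \<nu>)))
             - minkowski \<mu> \<nu> * (\<Sum>\<alpha>\<in>UNIV. minkowski \<alpha> \<alpha> * p $ (PotA \<alpha>, \<alpha>)))
      + h\<^sup>2 * (- (1/2) * minkowski \<mu> \<mu> * minkowski \<nu> \<nu>)"
    using exhaust_index[of \<mu>] exhaust_index[of \<nu>]
    by (elim disjE; simp add: explicit axis_def minkowski_def sum_index; simp add: power2_eq_square field_simps)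
qed

lemma partial_quadratic:
  assumes "\<And>h. f (x + h *\<^sub>R axis i 1) = a + h * b + h\<^sup>2 * c"
  shows "partial i f x = b"
  unfolding partial_def assms
  by (rule DERIV_imp_deriv) (auto intro!: derivative_eq_intros)

lemma lagrangian_partial_ScalZ:
  "partial (ScalZ, \<mu>) (lagrangian q) p = - minkowski \<mu> \<mu> * p $ (ScalZ, \<mu>)"
  by (rule partial_quadratic) (rule lagrangian_along_axis)

lemma lagrangian_partial_PotA:
  "partial (PotA \<nu>, \<mu>) (lagrangian q) p =
     - (minkowski \<mu> \<mu> * minkowski \<nu> \<nu> * (p $ (PotA \<nu>, \<mu>) - p $ (PotA \<mu>, \<nu>)))
     - minkowski \<mu> \<nu> * (\<Sum>\<alpha>\<in>UNIV. minkowski \<alpha> \<alpha> * p $ (PotA \<alpha>, \<alpha>))"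
  by (rule partial_quadratic) (rule lagrangian_along_axis)

text \<open>The undifferentiated fields do not occur in the density, so the term \<open>\<partial>\<Lambda>/\<partial>u\<close> vanishes.\<close>

lemma euler_lagrange_imp_divergence:
  assumes "euler_lagrange lagrangian u a"
  shows "(\<Sum>\<mu>\<in>UNIV. partial \<mu>
      (\<lambda>y. partial (a, \<mu>) (lagrangian (field_values u y)) (field_gradients u y)) x) = 0"
proof -
  have "partial a (\<lambda>q. lagrangian q p) q = 0" for p q
    by (simp add: lagrangian_def)
  then show ?thesis
    using assms unfolding euler_lagrange_def by simp
qed

lemma wave_equation:
  assumes "smooth Z" and "euler_lagrange lagrangian (fields A Z) ScalZ"
  shows "(\<Sum>\<alpha>\<in>UNIV. \<Sum>\<beta>\<in>UNIV. minkowski \<alpha> \<beta> * partial \<alpha> (partial \<beta> Z) x) = 0"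
proof -
  have "(\<Sum>\<mu>\<in>UNIV. partial \<mu> (\<lambda>y. - minkowski \<mu> \<mu> * partial \<mu> Z y) x) = 0"
    using euler_lagrange_imp_divergence[OF assms(2), of x]
    by (simp only: lagrangian_partial_ScalZ field_gradients_def vec_lambda_beta fst_conv snd_conv fields.simps)
  moreover have "partial \<mu> Z differentiable (at x)" for \<mu>
    using assms(1) by (intro smooth_differentiable smooth_partial)
  ultimately show ?thesis
    by (simp add: partial_linear sum_index minkowski_def)
qed

lemma field_equation:
  assumes "\<And>\<nu>. smooth (A \<nu>)" and "euler_lagrange lagrangian (fields A Z) (PotA \<mu>)"
  shows "(\<Sum>\<nu>\<in>UNIV. partial \<nu> (\<lambda>y. Fup A \<mu> \<nu> y - minkowski \<mu> \<nu> * psi_field A y) x) = 0"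
proof -
  \<comment> \<open>\<open>\<partial>\<Lambda>/\<partial>(\<partial>\<^sub>\<nu> A\<^sub>\<mu>)\<close> is \<open>- F\<^sup>\<nu>\<^sup>\<mu> - g\<^sup>\<nu>\<^sup>\<mu> \<psi>\<close>; the antisymmetry of \<open>F\<close> removes the first sign.\<close>
  have "partial (PotA \<mu>, \<nu>) (lagrangian q) (field_gradients (fields A Z) y)
      = Fup A \<mu> \<nu> y - minkowski \<mu> \<nu> * psi_field A y" for \<nu> q y
    by (simp add: lagrangian_partial_PotA field_gradients_def Fup_diagonal Fdown_def
        psi_field_eq assms(1) minkowski_def algebra_simps)
  then show ?thesis
    using euler_lagrange_imp_divergence[OF assms(2), of x] by simp
qed

section \<open>The Maxwell-GLM system\<close>

theorem mainTheorem5: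
  fixes A :: "4 \<Rightarrow> real^4 \<Rightarrow> real" and Z :: "real^4 \<Rightarrow> real"
  assumes smooth_A: "\<And>\<nu>. smooth (A \<nu>)" and smooth_Z: "smooth Z"
    and EL_Z: "euler_lagrange lagrangian (fields A Z) ScalZ"
    and EL_A: "\<And>\<nu>. euler_lagrange lagrangian (fields A Z) (PotA \<nu>)"
  shows "(\<forall>x. B_field A Z x = curl (vector_potential A) x + grad Z x)
    \<and> (\<forall>x. (\<Sum>\<alpha>\<in>UNIV. \<Sum>\<beta>\<in>UNIV. minkowski \<alpha> \<beta> * partial \<alpha> (partial \<beta> Z) x) = 0)
    \<and> (\<forall>\<mu> x. (\<Sum>\<nu>\<in>UNIV. partial \<nu>
           (\<lambda>y. dualFup A \<mu> \<nu> y - time_vec \<nu> * raise1 (\<lambda>\<alpha>. partial \<alpha> Z y) \<mu> - minkowski \<mu> \<nu> * phi_field Z y) x) = 0)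
    \<and> (\<forall>\<mu> x. (\<Sum>\<nu>\<in>UNIV. partial \<nu> (\<lambda>y. Fup A \<mu> \<nu> y - minkowski \<mu> \<nu> * psi_field A y) x) = 0)
    \<and> (\<forall>x. d_t (B_field A Z) x + curl (E_field A) x + grad (phi_field Z) x = 0)
    \<and> (\<forall>x. partial 0 (phi_field Z) x + divergence (B_field A Z) x = 0)
    \<and> (\<forall>x. d_t (E_field A) x - curl (B_field A Z) x + grad (psi_field A) x = 0)
    \<and> (\<forall>x. partial 0 (psi_field A) x + divergence (E_field A) x = 0)"
proof -
  have diff: "partial \<mu> (A \<nu>) differentiable (at x)" "partial \<mu> Z differentiable (at x)" for \<mu> \<nu> x
    using smooth_A smooth_Z by (auto intro!: smooth_differentiable smooth_partial)
  have F_diff: "Fdown A \<mu> \<nu> differentiable (at x)" for \<mu> \<nu> x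
    unfolding Fdown_def[abs_def] by (intro differentiable_diff diff)
  have phi_diff: "phi_field Z differentiable (at x)" for x
    unfolding phi_field_def[abs_def] by (intro differentiable_minus diff)
  have psi_diff: "psi_field A differentiable (at x)" for x
    unfolding psi_field_eq[OF smooth_A, abs_def]
    by (simp add: sum_index diff)
  have partial_F: "partial \<alpha> (Fdown A \<mu> \<nu>) x
      = partial \<alpha> (partial \<mu> (A \<nu>)) x - partial \<alpha> (partial \<nu> (A \<mu>)) x" for \<alpha> \<mu> \<nu> x
    unfolding Fdown_def[abs_def] by (simp add: partial_diff diff)
  have partial_phi: "partial \<alpha> (phi_field Z) x = - partial \<alpha> (partial 0 Z) x" for \<alpha> x
    unfolding phi_field_def[abs_def] by (simp add: partial_minus diff)
  note sym = smooth_partial_commute[OF smooth_Z] smooth_partial_commute[OF smooth_A]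

  have E: "E_field A x = vector [Fdown A 1 0 x, Fdown A 2 0 x, Fdown A 3 0 x]" for x
    by (simp add: E_field_def spatial_def sum_index time_vec_def)
  have B: "B_field A Z x = vector [Fdown A 2 3 x + partial 1 Z x, Fdown A 3 1 x + partial 2 Z x,
      Fdown A 1 2 x + partial 3 Z x]" for x
    by (simp add: B_field_def spatial_def sum_index time_vec_def dualFdown_def lower2_diagonal
        minkowski_def dualFup_table Fdown_swap[of A 3 2] Fdown_swap[of A 1 3] Fdown_swap[of A 2 1] add.commute)

  have B_curl: "B_field A Z x = curl (vector_potential A) x + grad Z x" for x
    by (simp add: B curl_def grad_def vector_potential_def spatial_def Fdown_def vec_eq_iff forall_3)
  have wave: "(\<Sum>\<alpha>\<in>UNIV. \<Sum>\<beta>\<in>UNIV. minkowski \<alpha> \<beta> * partial \<alpha> (partial \<beta> Z) x) = 0" for x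
    by (rule wave_equation[OF smooth_Z EL_Z])
  have field_eq: "(\<Sum>\<nu>\<in>UNIV. partial \<nu> (\<lambda>y. Fup A \<mu> \<nu> y - minkowski \<mu> \<nu> * psi_field A y) x) = 0" for \<mu> x
    by (rule field_equation[OF smooth_A EL_A])
  \<comment> \<open>Identities for arbitrary smooth \<open>A\<close> and \<open>Z\<close>; ordered rewriting with \<open>sym\<close> cancels the mixed
    derivatives.\<close>
  have dual: "(\<Sum>\<nu>\<in>UNIV. partial \<nu>
           (\<lambda>y. dualFup A \<mu> \<nu> y - time_vec \<nu> * raise1 (\<lambda>\<alpha>. partial \<alpha> Z y) \<mu> - minkowski \<mu> \<nu> * phi_field Z y) x) = 0"
    for \<mu> x
    using exhaust_index[of \<mu>]
    by (elim disjE; simp add: sum_index dualFup_table dualFup_upper_triangle raise1_diagonal time_vec_def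
        minkowski_def partial_linear partial_F partial_phi F_diff phi_diff diff sym)
  have faraday: "d_t (B_field A Z) x + curl (E_field A) x + grad (phi_field Z) x = 0" for x
    by (simp add: vec_eq_iff forall_3 d_t_def curl_def grad_def spatial_def E B
        partial_linear partial_F partial_phi F_diff diff sym)
  have gauss_B: "partial 0 (phi_field Z) x + divergence (B_field A Z) x = 0" for x
    using wave[of x]
    by (simp add: divergence_def B sum_index minkowski_def
        partial_linear partial_F partial_phi F_diff diff sym)
  have flux: "(\<Sum>\<nu>\<in>UNIV. minkowski \<mu> \<mu> * minkowski \<nu> \<nu> * partial \<nu> (Fdown A \<mu> \<nu>) x
      - minkowski \<mu> \<nu> * partial \<nu> (psi_field A) x) = 0" for \<mu> x
    using field_eq[of \<mu> x]
    by (simp add: Fup_diagonal partial_linear F_diff psi_diff)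
  have ampere: "d_t (E_field A) x - curl (B_field A Z) x + grad (psi_field A) x = 0" for x
    using flux[of 1 x] flux[of 2 x] flux[of 3 x]
    by (simp add: vec_eq_iff forall_3 d_t_def curl_def grad_def spatial_def E B sum_index minkowski_def
        partial_linear partial_F F_diff diff sym)
  have gauss_E: "partial 0 (psi_field A) x + divergence (E_field A) x = 0" for x
    using flux[of 0 x]
    by (simp add: divergence_def E sum_index minkowski_def partial_linear partial_F F_diff diff sym)
  show ?thesis
    using B_curl wave dual field_eq faraday gauss_B ampere gauss_E by blast
qed

end
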